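(* Let $(X,S)$ be a subshift of $\{0,1\}^{\mathbb Z}$ and let $(\widetilde X,S)$ be its hereditary closure. Let $\nu\in\mathcal M^e(X,S)$ be a non-atomic measure with $D_\nu=D$, let $0<q<1$, and let $\kappa=\nu*B_{q,1-q}\in\mathcal M^e(\widetilde X,S)$. Let $\widetilde\phi:\widetilde X\to\mathbb R$ be a continuous function with $D^{\widetilde\phi}_\kappa=D^{\widetilde\phi}$, and let $\widetilde P=P(\widetilde X,\widetilde\phi)$. If $$\widetilde P\le\big(\mathrm{Var}\,\widetilde\phi([0])-\log(1-q)-\mathrm{Var}\,\widetilde\phi([1])\big)d+d^{\widetilde\phi}-\mathrm{Var}\,\widetilde\phi([0]),$$ $$\sup\widetilde\phi([1])\ge\sup\widetilde\phi([0]),$$ and $$\mathrm{Var}\,\widetilde\phi([1])\le\mathrm{Var}\,\widetilde\phi([0])-\log(1-q),$$ then $\kappa$ is not a Gibbs measure for $\widetilde\phi$.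
   Context: A subshift $(X,S)$ is a closed shift-invariant subset $X\subset\{0,1\}^{\mathbb Z}$ with $S$ the restriction of the left shift $(x_i)\mapsto(x_{i+1})$. $\mathcal M(X,S)$ (resp. $\mathcal M^e(X,S)$) is the set of $S$-invariant (resp. ergodic $S$-invariant) Borel probability measures on $X$. $\mathcal L_n(X)$ is the set of words $W=[w_0\cdots w_{n-1}]$ such that some $x\in X$ has $x_i=w_i$ for $0\le i\le n-1$; $W$ also denotes the cylinder set $\{x\in X: x_0\cdots x_{n-1}=W\}$ (in the subshift under consideration), e.g. $[0]=\{x:x_0=0\}$, $[1]=\{x:x_0=1\}$. $\#_1W$ is the number of indices $i$ with $w_i=1$. Logarithms are to base 2. Hereditary closure: $\widetilde X=\{y\in\{0,1\}^{\mathbb Z}:\exists x\in X,\ y_i\le x_i\ \forall i\in\mathbb Z\}$; the shift on $\widetilde X$ is also denoted $S$. Multiplicative convolution: for $\nu\in\mathcal M(X,S)$ and $\mu$ a shift-invariant Borel probability measure on $\{0,1\}^{\mathbb Z}$, $\nu*\mu=(\nu\otimes\mu)\circ Q^{-1}\in\mathcal M(\widetilde X,S)$, where $Q:X\times\{0,1\}^{\mathbb Z}\to\widetilde X$, $Q(x,y)=(x_iy_i)_{i\in\mathbb Z}$. $B_{q,1-q}$ is the Bernoulli measure on $\{0,1\}^{\mathbb Z}$ with $B_{q,1-q}([0])=q$, $B_{q,1-q}([1])=1-q$. Densities for $(X,S)$: $d=\sup_{\mu\in\mathcal M(X,S)}\mu([1])$, $D=\lim_{n}\frac1n\max_{W\in\mathcal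 L_n(X)}\#_1W$, $D_\nu=\lim_n\frac1n\max_{W\in\mathcal L_n(X),\,\nu(W)>0}\#_1W$. Densities for a continuous function on $\widetilde X$: $D^{\widetilde\phi}=\lim_n\frac1n\sup_{x\in\widetilde X}\sum_{i=0}^{n-1}\widetilde\phi(S^ix)$, $d^{\widetilde\phi}=\sup_{\mu\in\mathcal M^e(\widetilde X,S)}\int\widetilde\phi\,d\mu$, $D^{\widetilde\phi}_\kappa=\lim_n\frac1n\max_{W\in\mathcal L_n(\widetilde X),\,\kappa(W)>0}\ \sup_{x\in W}\sum_{i=0}^{n-1}\widetilde\phi(S^ix)$. $\mathrm{Var}\,\widetilde\phi(A)=\sup\widetilde\phi(A)-\inf\widetilde\phi(A)$ for $A\subset\widetilde X$. Topological pressure: $P(\widetilde X,\widetilde\phi)=\lim_n\frac1n\log\sum_{W\in\mathcal L_n(\widetilde X)}2^{\sup_{x\in W}\sum_{i=0}^{n-1}\widetilde\phi(S^ix)}$. Gibbs measure: for a subshift $(Y,S)$ and continuous $\phi:Y\to\mathbb R$, a measure $\mu\in\mathcal M(Y,S)$ is a Gibbs measure for $\phi$ if there exist $P=P(Y,\phi)\ge0$ and $c>0$ such that for all $n\in\mathbb N$, every word $C\in\mathcal L_n(Y)$ with $\mu(C)>0$ and every $x\in C$, $c^{-1}\le \mu(C)\big/2^{\sum_{i=0}^{n-1}\phi(S^ix)-nP}\le c$; the constant $P$ here is the topological pressure of $\phi$ on $(Y,S)$. *)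

theory Defs
  imports "HOL-Probability.Probability"
begin

text \<open>
  The alphabet $\{0,1\}$ is \<^typ>\<open>bool\<close>, with \<^const>\<open>False\<close> for 0 and \<^const>\<open>True\<close> for 1, so
  that the order and the product of $\{0,1\}$ are \<open>\<le>\<close> and \<open>\<and>\<close>.  The type
  \<open>int \<Rightarrow> bool\<close> carries the product topology of the discrete topology on
  \<^typ>\<open>bool\<close>.
\<close>

type_synonym bseq = "int \<Rightarrow> bool"

definition left_shift :: "bseq \<Rightarrow> bseq" where
  "left_shift x = (\<lambda>i. x (i + 1))"

definition subshift :: "bseq set \<Rightarrow> bool" where
  "subshift X \<longleftrightarrow> closed X \<and> left_shift ` X = X"

definition language :: "nat \<Rightarrow> bseq set \<Rightarrow> bool list set" where
  "language n X = {W. length W = n \<and> (\<exists>x\<in>X. \<forall>i<n. x (int i) = W ! i)}"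

definition cylinder :: "bseq set \<Rightarrow> bool list \<Rightarrow> bseq set" where
  "cylinder X W = {x \<in> X. \<forall>i<length W. x (int i) = W ! i}"

definition num_ones :: "bool list \<Rightarrow> nat" where
  "num_ones W = card {i. i < length W \<and> W ! i}"

definition hereditary_closure :: "bseq set \<Rightarrow> bseq set" where
  "hereditary_closure X = {y. \<exists>x\<in>X. \<forall>i. y i \<le> x i}"

text \<open>Measures on \<open>X\<close> are measures whose space is \<open>X\<close> itself, with the Borel sets of the
  subspace \<open>X\<close>.\<close>

definition invariant_measures :: "bseq set \<Rightarrow> bseq measure set" where
  "invariant_measures X =
     {\<mu>. sets \<mu> = sets (restrict_space borel X) \<and> prob_space \<mu> \<and> distr \<mu> \<mu> left_shift = \<mu>}"

definition ergodic_measures :: "bseq set \<Rightarrow> bseq measure set" where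
  "ergodic_measures X =
     {\<mu> \<in> invariant_measures X.
        \<forall>A\<in>sets \<mu>. left_shift -` A \<inter> space \<mu> = A \<longrightarrow> measure \<mu> A = 0 \<or> measure \<mu> A = 1}"

definition non_atomic :: "'a measure \<Rightarrow> bool" where
  "non_atomic \<mu> \<longleftrightarrow>
     (\<forall>A\<in>sets \<mu>. 0 < measure \<mu> A \<longrightarrow>
        (\<exists>B\<in>sets \<mu>. B \<subseteq> A \<and> 0 < measure \<mu> B \<and> measure \<mu> B < measure \<mu> A))"

definition mult_conv :: "bseq set \<Rightarrow> bseq measure \<Rightarrow> bseq measure \<Rightarrow> bseq measure" where
  "mult_conv X \<nu> \<mu> =
     distr (\<nu> \<Otimes>\<^sub>M \<mu>) (restrict_space borel (hereditary_closure X)) (\<lambda>(x, y). (\<lambda>i. x i \<and> y i))"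

text \<open>\<open>bernoulli_pmf p\<close> gives mass \<open>p\<close> to \<^const>\<open>True\<close>, so here the symbol 0 has
  probability \<open>q\<close>.\<close>

definition bernoulli_measure :: "real \<Rightarrow> bseq measure" where
  "bernoulli_measure q = (\<Pi>\<^sub>M i\<in>UNIV. measure_pmf (bernoulli_pmf (1 - q)))"

text \<open>The densities $d$, $D$ and $D_\nu$ of a subshift.\<close>

definition dens_sup :: "bseq set \<Rightarrow> real" where
  "dens_sup X = (SUP \<mu>\<in>invariant_measures X. measure \<mu> (cylinder X [True]))"

definition dens_max :: "bseq set \<Rightarrow> real" where
  "dens_max X = lim (\<lambda>n. real (Max (num_ones ` language n X)) / real n)"

definition dens_max_measure :: "bseq set \<Rightarrow> bseq measure \<Rightarrow> real" where
  "dens_max_measure X \<nu> =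
     lim (\<lambda>n. real (Max (num_ones ` {W \<in> language n X. 0 < measure \<nu> (cylinder X W)})) / real n)"

definition birkhoff_sum :: "(bseq \<Rightarrow> real) \<Rightarrow> nat \<Rightarrow> bseq \<Rightarrow> real" where
  "birkhoff_sum \<phi> n x = (\<Sum>i<n. \<phi> ((left_shift ^^ i) x))"

text \<open>The densities $d^\phi$, $D^\phi$ and $D^\phi_\kappa$ of a continuous function on a
  subshift \<open>Y\<close>.\<close>

definition fdens_sup :: "bseq set \<Rightarrow> (bseq \<Rightarrow> real) \<Rightarrow> real" where
  "fdens_sup Y \<phi> = (SUP \<mu>\<in>ergodic_measures Y. \<integral>x. \<phi> x \<partial>\<mu>)"

definition fdens_max :: "bseq set \<Rightarrow> (bseq \<Rightarrow> real) \<Rightarrow> real" where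
  "fdens_max Y \<phi> = lim (\<lambda>n. (SUP x\<in>Y. birkhoff_sum \<phi> n x) / real n)"

definition fdens_max_measure :: "bseq set \<Rightarrow> (bseq \<Rightarrow> real) \<Rightarrow> bseq measure \<Rightarrow> real" where
  "fdens_max_measure Y \<phi> \<kappa> =
     lim (\<lambda>n. Max ((\<lambda>W. SUP x\<in>cylinder Y W. birkhoff_sum \<phi> n x) `
                    {W \<in> language n Y. 0 < measure \<kappa> (cylinder Y W)}) / real n)"

definition Var :: "(bseq \<Rightarrow> real) \<Rightarrow> bseq set \<Rightarrow> real" where
  "Var \<phi> A = (SUP x\<in>A. \<phi> x) - (INF x\<in>A. \<phi> x)"

definition pressure :: "bseq set \<Rightarrow> (bseq \<Rightarrow> real) \<Rightarrow> real" where
  "pressure Y \<phi> =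
     lim (\<lambda>n. log 2 (\<Sum>W\<in>language n Y. 2 powr (SUP x\<in>cylinder Y W. birkhoff_sum \<phi> n x)) / real n)"

definition gibbs_measure :: "bseq set \<Rightarrow> (bseq \<Rightarrow> real) \<Rightarrow> bseq measure \<Rightarrow> bool" where
  "gibbs_measure Y \<phi> \<mu> \<longleftrightarrow>
     \<mu> \<in> invariant_measures Y \<and>
     (\<exists>P c. P = pressure Y \<phi> \<and> 0 \<le> P \<and> 0 < c \<and>
        (\<forall>n. \<forall>C\<in>language n Y. 0 < measure \<mu> (cylinder Y C) \<longrightarrow>
           (\<forall>x\<in>cylinder Y C.
              1 / c \<le> measure \<mu> (cylinder Y C) / 2 powr (birkhoff_sum \<phi> n x - real n * P) \<and>
              measure \<mu> (cylinder Y C) / 2 powr (birkhoff_sum \<phi> n x - real n * P) \<le> c)))"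

instance bool :: second_countable_topology
proof
  show "\<exists>B::bool set set. countable B \<and> open = generate_topology B"
    by (rule exI[of _ "range lessThan \<union> range greaterThan"]) (auto simp: open_bool_def)
qed

lemma left_shift_eq: "left_shift = (\<lambda>x i. x (i + 1))"
  by (simp add: fun_eq_iff left_shift_def)

lemma borel_bool: "sets (borel :: bool measure) = UNIV"
  by (metis UNIV_eq_I borel_open Topological_Spaces.open_discrete)

lemma open_coord: "open {x::bseq. x i = b}"
proof -
  have "continuous_on UNIV (\<lambda>x::bseq. x i)" by (rule continuous_on_product_coordinates)
  hence "open ((\<lambda>x::bseq. x i) -` {b})" by (intro open_vimage Topological_Spaces.open_discrete)
  thus ?thesis by (simp add: vimage_def)
qed

lemma sets_bernoulli_measure: "sets (bernoulli_measure q) = sets (borel :: bseq measure)"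
proof -
  have "sets (bernoulli_measure q) = sets (\<Pi>\<^sub>M i\<in>(UNIV::int set). (borel :: bool measure))"
    unfolding bernoulli_measure_def by (intro sets_PiM_cong) (auto simp: borel_bool)
  also have "\<dots> = sets borel" by (rule sets_PiM_equal_borel)
  finally show ?thesis .
qed

lemma compact_UNIV_bseq: "compact (UNIV :: bseq set)"
proof -
  have "finite (UNIV :: bool set)" by simp
  hence "compact_space (product_topology (\<lambda>i::int. (euclidean :: bool topology)) UNIV)"
    by (subst compact_space_product_topology) (auto simp: compact_space_def intro: finite_imp_compact)
  thus ?thesis
    by (simp add: euclidean_product_topology compact_space_def)
qed

lemma compact_bseq_imp_closed:
  assumes "compact (A :: bseq set)"
  shows "closed A"
proof -
  have "Hausdorff_space (euclidean :: bool topology)"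
    unfolding Hausdorff_space_def disjnt_def using hausdorff[where 'a=bool] by simp
  hence "Hausdorff_space (product_topology (\<lambda>i::int. (euclidean :: bool topology)) UNIV)"
    by (simp add: Hausdorff_space_product_topology)
  thus ?thesis
    using assms compactin_imp_closedin[of "euclidean :: bseq topology" A]
    by (simp add: euclidean_product_topology)
qed

lemma measurable_left_shift: "left_shift \<in> borel_measurable (borel :: bseq measure)"
  unfolding left_shift_eq
  by (intro borel_measurable_continuous_onI continuous_on_coordinatewise_then_product
            continuous_on_product_coordinates)

lemma prob_space_bernoulli_measure: "prob_space (bernoulli_measure q)"
  unfolding bernoulli_measure_def by (intro prob_space_PiM) (rule prob_space_measure_pmf)

lemma bernoulli_measure_cylinder:
  assumes "0 \<le> q" "q \<le> 1"
  shows "measure (bernoulli_measure q) (cylinder UNIV [False]) = q"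
    and "measure (bernoulli_measure q) (cylinder UNIV [True]) = 1 - q"
proof -
  interpret product_prob_space "\<lambda>i::int. measure_pmf (bernoulli_pmf (1 - q))" UNIV
    by unfold_locales
  have *: "cylinder UNIV [b] = prod_emb UNIV (\<lambda>i::int. measure_pmf (bernoulli_pmf (1 - q))) {0} (\<Pi>\<^sub>E i\<in>{0}. {b})" for b
    by (auto simp: cylinder_def prod_emb_def PiE_iff restrict_def fun_eq_iff)
  have "measure (bernoulli_measure q) (cylinder UNIV [b]) = pmf (bernoulli_pmf (1 - q)) b" for b
    unfolding bernoulli_measure_def *
    by (subst measure_PiM_emb) (auto simp: pmf.rep_eq)
  thus "measure (bernoulli_measure q) (cylinder UNIV [False]) = q"
    and "measure (bernoulli_measure q) (cylinder UNIV [True]) = 1 - q"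
    using assms by simp_all
qed

lemma bernoulli_measure_shift: "distr (bernoulli_measure q) (bernoulli_measure q) left_shift = bernoulli_measure q"
proof -
  have "distr (Pi\<^sub>M UNIV (\<lambda>i::int. measure_pmf (bernoulli_pmf (1 - q)))) (Pi\<^sub>M UNIV (\<lambda>i::int. measure_pmf (bernoulli_pmf (1 - q))))
     (\<lambda>\<omega>. \<lambda>n\<in>UNIV. \<omega> (n + 1)) = Pi\<^sub>M UNIV (\<lambda>i::int. measure_pmf (bernoulli_pmf (1 - q)))"
    by (rule distr_PiM_reindex) (auto intro: prob_space_measure_pmf)
  thus ?thesis by (simp add: bernoulli_measure_def left_shift_eq restrict_def)
qed

lemma subshift_hereditary_closure:
  assumes "subshift X"
  shows "subshift (hereditary_closure X)"
proof -
  have cl: "closed X" and sh: "left_shift ` X = X" using assms by (auto simp: subshift_def)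
  have cX: "compact X" using cl compact_UNIV_bseq by (metis compact_Int_closed inf_top_left)
  let ?Q = "\<lambda>(x::bseq, y::bseq). (\<lambda>i. x i \<and> y i)"
  have eq: "hereditary_closure X = ?Q ` (X \<times> UNIV)"
  proof (intro equalityI subsetI)
    fix y assume "y \<in> hereditary_closure X"
    then obtain x where "x \<in> X" "\<forall>i. y i \<le> x i" by (auto simp: hereditary_closure_def)
    hence "y = ?Q (x, y)" by (auto simp: fun_eq_iff)
    with \<open>x \<in> X\<close> show "y \<in> ?Q ` (X \<times> UNIV)" by blast
  qed (auto simp: hereditary_closure_def)
  have open_bool2: "open A" for A :: "(bool \<times> bool) set"
  proof -
    have "open ((\<Union>(a,b)\<in>A. {a} \<times> {b}))"
      by (intro open_UN ballI) (simp only: split_beta, intro open_Times Topological_Spaces.open_discrete)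
    moreover have "(\<Union>(a,b)\<in>A. {a} \<times> {b}) = A" by auto
    ultimately show ?thesis by (rule subst[rotated])
  qed
  have cont1: "continuous_on UNIV (\<lambda>z::bool \<times> bool. fst z \<and> snd z)"
    by (auto simp: continuous_on_open_vimage intro: open_bool2)
  have "continuous_on (X \<times> UNIV) ?Q"
    unfolding case_prod_beta
  proof (rule continuous_on_coordinatewise_then_product)
    fix i
    have c: "continuous_on UNIV (\<lambda>x::bseq. x i)" by (rule continuous_on_product_coordinates)
    have "continuous_on (X \<times> UNIV) (\<lambda>z::bseq \<times> bseq. fst z i)"
      by (rule continuous_on_compose2[OF c continuous_on_fst[OF continuous_on_id] subset_UNIV])
    moreover have "continuous_on (X \<times> UNIV) (\<lambda>z::bseq \<times> bseq. snd z i)"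
      by (rule continuous_on_compose2[OF c continuous_on_snd[OF continuous_on_id] subset_UNIV])
    ultimately have "continuous_on (X \<times> UNIV) (\<lambda>z::bseq \<times> bseq. (fst z i, snd z i))"
      by (rule continuous_on_Pair)
    from continuous_on_compose2[OF cont1 this]
    show "continuous_on (X \<times> UNIV) (\<lambda>z::bseq \<times> bseq. fst z i \<and> snd z i)" by simp
  qed
  hence "compact (hereditary_closure X)"
    using compact_continuous_image[OF _ compact_Times[OF cX compact_UNIV_bseq]] by (simp only: eq)
  moreover have "left_shift ` hereditary_closure X = hereditary_closure X"
  proof (intro equalityI subsetI)
    fix y assume "y \<in> left_shift ` hereditary_closure X"
    then obtain z x where z: "y = left_shift z" and x: "x \<in> X" and le: "\<forall>i. z i \<le> x i"
      by (auto simp: hereditary_closure_def)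
    have "left_shift x \<in> X" using sh x by blast
    moreover have "\<forall>i. y i \<le> left_shift x i" using le by (simp add: z left_shift_def)
    ultimately show "y \<in> hereditary_closure X" unfolding hereditary_closure_def by blast
  next
    fix y assume "y \<in> hereditary_closure X"
    then obtain x where x: "x \<in> X" "\<forall>i. y i \<le> x i" by (auto simp: hereditary_closure_def)
    then obtain u where u: "u \<in> X" "x = left_shift u" using sh by blast
    define z where "z = (\<lambda>i. y (i - 1))"
    have "z i \<le> u i" for i
      using x(2)[rule_format, of "i - 1"] u by (simp add: z_def left_shift_def)
    hence "z \<in> hereditary_closure X" using u(1) unfolding hereditary_closure_def by blast
    moreover have "y = left_shift z" by (simp add: z_def left_shift_def)
    ultimately show "y \<in> left_shift ` hereditary_closure X" by blast
  qed
  ultimately show ?thesis using compact_bseq_imp_closed by (simp add: subshift_def)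
qed

text \<open>The membership requirement in \<^const>\<open>gibbs_measure\<close> is always met by the
  convolution of an invariant measure with a Bernoulli measure.\<close>

lemma mult_conv_bernoulli_invariant:
  assumes "subshift X" "\<nu> \<in> invariant_measures X"
  shows "mult_conv X \<nu> (bernoulli_measure q) \<in> invariant_measures (hereditary_closure X)"
proof -
  let ?B = "bernoulli_measure q" and ?H = "hereditary_closure X"
  let ?R = "restrict_space borel ?H"
  let ?Q = "\<lambda>(x::bseq, y::bseq). (\<lambda>i. x i \<and> y i)"
  interpret B: prob_space ?B by (rule prob_space_bernoulli_measure)
  interpret N: prob_space \<nu> using assms by (simp add: invariant_measures_def)
  interpret P: pair_prob_space \<nu> ?B ..
  have sN: "sets \<nu> = sets (restrict_space borel X)" and iN: "distr \<nu> \<nu> left_shift = \<nu>"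
    using assms by (auto simp: invariant_measures_def)
  have spN: "space \<nu> = X" using sets_eq_imp_space_eq[OF sN] by (simp add: space_restrict_space)
  have sh: "left_shift ` X = X" using assms by (simp add: subshift_def)
  have shH: "left_shift ` ?H = ?H" using subshift_hereditary_closure[OF assms(1)] by (simp add: subshift_def)
  have mshift: "left_shift \<in> measurable (restrict_space borel Y) (restrict_space borel Y)" if "left_shift ` Y = Y" for Y
    by (rule measurable_restrict_space3[OF measurable_left_shift]) (use that in auto)
  have mN: "left_shift \<in> measurable \<nu> \<nu>"
    using mshift[OF sh] measurable_cong_sets[OF sN sN] by blast
  have mB: "left_shift \<in> measurable ?B ?B"
    using measurable_left_shift measurable_cong_sets[OF sets_bernoulli_measure sets_bernoulli_measure] by blast
  have coord: "(\<lambda>x::bseq. x i) \<in> measurable borel (count_space UNIV)" for i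
  proof -
    have "(\<lambda>x::bseq. x i) \<in> borel_measurable borel"
      by (intro borel_measurable_continuous_onI continuous_on_product_coordinates)
    moreover have "sets (borel::bool measure) = sets (count_space UNIV)" by (simp add: borel_bool)
    ultimately show ?thesis using measurable_cong_sets by blast
  qed
  have cN: "(\<lambda>x. x i) \<in> measurable \<nu> (count_space UNIV)" for i
    using measurable_restrict_space1[OF coord] measurable_cong_sets[OF sN refl] by blast
  have cB: "(\<lambda>x. x i) \<in> measurable ?B (count_space UNIV)" for i
    using coord measurable_cong_sets[OF sets_bernoulli_measure refl] by blast
  have mQ0: "?Q \<in> measurable (\<nu> \<Otimes>\<^sub>M ?B) borel"
  proof -
    have m1: "(\<lambda>z. fst z i) \<in> measurable (\<nu> \<Otimes>\<^sub>M ?B) (count_space UNIV)" for i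
      using measurable_compose[OF measurable_fst cN] .
    have m2: "(\<lambda>z. snd z i) \<in> measurable (\<nu> \<Otimes>\<^sub>M ?B) (count_space UNIV)" for i
      using measurable_compose[OF measurable_snd cB] .
    have "?Q \<in> measurable (\<nu> \<Otimes>\<^sub>M ?B) (\<Pi>\<^sub>M i\<in>(UNIV::int set). count_space (UNIV::bool set))"
      unfolding case_prod_beta
    proof (rule measurable_PiM_single')
      fix i :: int
      show "(\<lambda>z. fst z i \<and> snd z i) \<in> measurable (\<nu> \<Otimes>\<^sub>M ?B) (count_space UNIV)"
        using m1 m2 by (rule pred_intros_logic)
    qed auto
    moreover have "sets (\<Pi>\<^sub>M i\<in>(UNIV::int set). count_space (UNIV::bool set)) = sets (borel :: bseq measure)"
    proof -
      have "sets (\<Pi>\<^sub>M i\<in>(UNIV::int set). count_space (UNIV::bool set)) =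
          sets (\<Pi>\<^sub>M i\<in>(UNIV::int set). (borel :: bool measure))"
        by (rule sets_PiM_cong[OF refl]) (simp only: borel_bool sets_count_space Pow_UNIV)
      thus ?thesis by (rule trans[OF _ sets_PiM_equal_borel])
    qed
    ultimately show ?thesis using measurable_cong_sets by blast
  qed
  have mQ: "?Q \<in> measurable (\<nu> \<Otimes>\<^sub>M ?B) ?R"
    using mQ0 by (rule measurable_restrict_space2[rotated])
      (auto simp: hereditary_closure_def space_pair_measure spN)
  have mS: "(\<lambda>(x, y). (left_shift x, left_shift y)) \<in> measurable (\<nu> \<Otimes>\<^sub>M ?B) (\<nu> \<Otimes>\<^sub>M ?B)"
    unfolding case_prod_beta
    by (rule measurable_Pair[OF measurable_compose[OF measurable_fst mN] measurable_compose[OF measurable_snd mB]])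
  have "prob_space (mult_conv X \<nu> ?B)"
    unfolding mult_conv_def by (rule P.prob_space_distr[OF mQ])
  moreover have "sets (mult_conv X \<nu> ?B) = sets ?R" by (simp add: mult_conv_def)
  moreover have "distr (mult_conv X \<nu> ?B) (mult_conv X \<nu> ?B) left_shift = mult_conv X \<nu> ?B"
  proof -
    have "distr (mult_conv X \<nu> ?B) (mult_conv X \<nu> ?B) left_shift = distr (mult_conv X \<nu> ?B) ?R left_shift"
      by (rule distr_cong) (simp_all add: mult_conv_def)
    also have "\<dots> = distr (\<nu> \<Otimes>\<^sub>M ?B) ?R (left_shift \<circ> ?Q)"
      unfolding mult_conv_def by (rule distr_distr[OF mshift[OF shH] mQ])
    also have "left_shift \<circ> ?Q = ?Q \<circ> (\<lambda>(x, y). (left_shift x, left_shift y))"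
      by (auto simp: left_shift_def fun_eq_iff)
    also have "distr (\<nu> \<Otimes>\<^sub>M ?B) ?R (?Q \<circ> (\<lambda>(x, y). (left_shift x, left_shift y))) =
        distr (distr (\<nu> \<Otimes>\<^sub>M ?B) (\<nu> \<Otimes>\<^sub>M ?B) (\<lambda>(x, y). (left_shift x, left_shift y))) ?R ?Q"
      by (rule distr_distr[symmetric, OF mQ mS])
    also have "distr (\<nu> \<Otimes>\<^sub>M ?B) (\<nu> \<Otimes>\<^sub>M ?B) (\<lambda>(x, y). (left_shift x, left_shift y)) = \<nu> \<Otimes>\<^sub>M ?B"
      using pair_measure_distr[OF mN mB] B.sigma_finite_measure_axioms
      by (simp add: iN bernoulli_measure_shift)
    finally show ?thesis by (simp add: mult_conv_def)
  qed
  ultimately show ?thesis by (simp add: invariant_measures_def)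
qed

end

theory Submission
  imports Defs
begin

text \<open>
  Among the words of length \<open>n\<close> that are charged by \<open>\<nu>\<close>, let \<open>W\<close> be one with the most ones, and let
  \<open>k\<close> be their number.  In the convolution, a word arises from the words of \<open>X\<close> that dominate it by
  erasing ones.  No other word charged by \<open>\<nu>\<close> dominates \<open>W\<close>, so the only way to produce \<open>W\<close> is to
  take \<open>W\<close> itself and erase nothing: \<open>\<kappa>(W) = \<nu>(W) (1 - q)\<^sup>k\<close> (\<open>mult_conv_maximal_word\<close>).

  The hypotheses make the Gibbs bound for such a word too generous.  Subadditivity
  (\<open>factorial_language_density\<close>) and the equality of the two densities give \<open>k \<ge> n D\<close>, while no
  invariant measure on \<open>X\<close> or on its hereditary closure gives the symbol 1 a mass above \<open>D\<close>
  (\<open>measure_one_le_frequency\<close>).  Write \<open>s\<^sub>1\<close>, \<open>s\<^sub>0\<close> for the suprema of \<open>\<phi>\<close> on \<open>[1]\<close>, \<open>[0]\<close> and \<open>v\<^sub>1\<close>,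
  \<open>v\<^sub>0\<close> for its variations there.  Splitting an integral according to the symbol at 0, and using
  \<open>s\<^sub>1 \<ge> s\<^sub>0\<close>, the largest ergodic integral of \<open>\<phi>\<close> is at most \<open>s\<^sub>0 + D (s\<^sub>1 - s\<^sub>0)\<close>.  Inserted into
  the assumption on the pressure \<open>P\<close>, this yields
  \<open>n P \<le> k (s\<^sub>1 - v\<^sub>1) + (n - k) (s\<^sub>0 - v\<^sub>0) - k log (1 - q)\<close>.  Here \<open>s\<^sub>1 - v\<^sub>1\<close> and \<open>s\<^sub>0 - v\<^sub>0\<close> are the
  infima of \<open>\<phi>\<close> on \<open>[1]\<close> and \<open>[0]\<close>, so the first two terms bound the Birkhoff sum along \<open>W\<close> from
  below, and its excess over \<open>n P\<close> is at least \<open>k log (1 - q)\<close>.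

  If \<open>\<kappa>\<close> were Gibbs with constant \<open>c\<close>, then \<open>\<kappa>(W) \<ge> (1 - q)\<^sup>k / c\<close>, hence \<open>\<nu>(W) \<ge> 1 / c\<close>, for such a
  word of every length.  But a non-atomic invariant measure gives small mass to all long words
  (\<open>non_atomic_small_words\<close>).
\<close>

section \<open>Words of a sequence\<close>

definition word :: "nat \<Rightarrow> bseq \<Rightarrow> bool list" where
  "word n x = map (\<lambda>i. x (int i)) [0..<n]"

lemma length_word [simp]: "length (word n x) = n"
  by (simp add: word_def)

lemma word_eq_iff: "word n x = W \<longleftrightarrow> length W = n \<and> (\<forall>i<n. x (int i) = W ! i)"
  by (auto simp: word_def list_eq_iff_nth_eq)

lemma language_eq: "language n X = word n ` X"
proof -
  have "W \<in> language n X \<longleftrightarrow> (\<exists>x\<in>X. word n x = W)" for W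
    unfolding word_eq_iff language_def by blast
  thus ?thesis by (auto simp only: set_eq_iff image_iff)
qed

lemma cylinder_eq: "cylinder X W = {x \<in> X. word (length W) x = W}"
  by (auto simp: cylinder_def word_eq_iff)

lemma finite_language [simp]: "finite (language n X)"
proof (rule finite_subset)
  show "language n X \<subseteq> {W. set W \<subseteq> UNIV \<and> length W = n}"
    by (auto simp: language_def)
qed (rule finite_lists_length_eq, simp)

lemma closed_imp_compact_bseq:
  assumes "closed (Y :: bseq set)"
  shows "compact Y"
  using compact_Int_closed[OF compact_UNIV_bseq assms] by simp

lemma left_shift_funpow: "(left_shift ^^ m) x = (\<lambda>i. x (i + int m))"
  by (induction m arbitrary: x) (auto simp: left_shift_def fun_eq_iff algebra_simps)

lemma subshift_funpow:
  assumes "subshift X" "x \<in> X"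
  shows "(left_shift ^^ m) x \<in> X"
  using assms by (induction m) (auto simp: subshift_def)

lemma take_word: "take m (word (m + n) x) = word m x"
  by (auto simp: word_def list_eq_iff_nth_eq)

lemma drop_word: "drop m (word (m + n) x) = word n ((left_shift ^^ m) x)"
  by (auto simp: word_def list_eq_iff_nth_eq left_shift_funpow algebra_simps)

lemma num_ones_word: "num_ones (word n x) = card {i. i < n \<and> x (int i)}"
proof -
  have "{i. i < n \<and> word n x ! i} = {i. i < n \<and> x (int i)}"
    by (auto simp: word_def)
  thus ?thesis by (simp add: num_ones_def)
qed

lemma num_ones_append: "num_ones (U @ V) = num_ones U + num_ones V"
proof -
  have "num_ones W = length (filter id W)" for W
    by (simp add: num_ones_def length_filter_conv_card)
  thus ?thesis by simp
qed

lemma num_ones_word_sum: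
  "real (num_ones (word n x)) = (\<Sum>i<n. if x (int i) then 1 else 0)"
  by (subst sum.inter_filter[symmetric])
     (auto simp: num_ones_word intro!: arg_cong[where f = card])

section \<open>Growth of factorial languages\<close>

text \<open>
  Fekete's lemma: for fixed \<open>m\<close>, division with remainder gives \<open>a n \<le> (n div m) a m + a (n mod m)\<close>,
  and the last term is bounded.  Hence the limit superior of \<open>a n / n\<close> is at most each \<open>a m / m\<close>, and
  the limit is the infimum.
\<close>

lemma fekete:
  fixes a :: "nat \<Rightarrow> real"
  assumes sub: "\<And>m n. a (m + n) \<le> a m + a n" and nonneg: "\<And>n. 0 \<le> a n"
  obtains L where "(\<lambda>n. a n / real n) \<longlonglongrightarrow> L" "\<And>n. 0 < n \<Longrightarrow> real n * L \<le> a n"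
proof
  define L where "L = (INF n\<in>{0<..}. a n / real n)"
  have bdd: "bdd_below ((\<lambda>n. a n / real n) ` {0<..})"
    by (rule bdd_belowI[of _ 0]) (auto simp: nonneg)
  have le: "L \<le> a n / real n" if "0 < n" for n
    unfolding L_def by (rule cINF_lower[OF bdd]) (use that in auto)
  show "real n * L \<le> a n" if "0 < n" for n
    using le[OF that] that by (simp add: field_simps)
  have mult: "a (k * m + r) \<le> real k * a m + a r" for k m r
  proof (induction k)
    case (Suc k)
    have "a (Suc k * m + r) \<le> a m + a (k * m + r)"
      using sub[of m "k * m + r"] by (simp add: algebra_simps)
    thus ?case using Suc by (simp add: algebra_simps)
  qed simp
  show "(\<lambda>n. a n / real n) \<longlonglongrightarrow> L"
  proof (rule LIMSEQ_I)
    fix \<epsilon> :: real assume \<epsilon>: "0 < \<epsilon>"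
    have "\<exists>m\<in>{0<..}. a m / real m < L + \<epsilon> / 2"
      using \<epsilon> by (subst cINF_less_iff[OF _ bdd, symmetric]) (auto simp: L_def)
    then obtain m where m: "0 < m" "a m / real m < L + \<epsilon> / 2" by auto
    define M where "M = (\<Sum>r<m. a r)"
    have M: "a (n mod m) \<le> M" for n
      unfolding M_def by (rule member_le_sum) (use m nonneg in auto)
    obtain N :: nat where N: "2 * M / \<epsilon> < real N" using reals_Archimedean2 by blast
    show "\<exists>no. \<forall>n\<ge>no. norm (a n / real n - L) < \<epsilon>"
    proof (intro exI[of _ "Suc N"] allI impI)
      fix n assume n: "Suc N \<le> n"
      have div: "real (n div m) \<le> real n / real m"
        by (rule of_nat_div_le_of_nat)
      have "a n \<le> real (n div m) * a m + a (n mod m)"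
        using mult[of "n div m" m "n mod m"] by simp
      also have "\<dots> \<le> real n / real m * a m + M"
        by (intro add_mono mult_right_mono div nonneg M)
      finally have "a n / real n \<le> a m / real m + M / real n"
        using n m by (simp add: field_simps)
      moreover have "2 * M / \<epsilon> < real n" using N n by simp
      hence "M / real n < \<epsilon> / 2" using \<epsilon> n by (simp add: field_simps)
      ultimately have "a n / real n < L + \<epsilon>" using m by linarith
      moreover have "L \<le> a n / real n" using le n by simp
      ultimately show "norm (a n / real n - L) < \<epsilon>" by simp
    qed
  qed
qed

text \<open>
  Cutting a word of length \<open>m + n\<close> into two shows that the maximal number of ones is subadditive.
  The family \<open>\<L>\<close> is abstract because this serves both the whole language of a subshift and
  the words charged by an invariant measure.
\<close>

lemma factorial_language_density:
  fixes \<L> :: "nat \<Rightarrow> bool list set"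
  assumes ne: "\<And>n. \<L> n \<noteq> {}" and len: "\<And>n W. W \<in> \<L> n \<Longrightarrow> length W = n"
    and fact: "\<And>m n W. W \<in> \<L> (m + n) \<Longrightarrow> take m W \<in> \<L> m \<and> drop m W \<in> \<L> n"
  shows "(\<lambda>n. real (Max (num_ones ` \<L> n)) / real n) \<longlonglongrightarrow>
      lim (\<lambda>n. real (Max (num_ones ` \<L> n)) / real n)" (is ?conv)
    and "0 < N \<Longrightarrow> real N * lim (\<lambda>n. real (Max (num_ones ` \<L> n)) / real n) \<le>
      real (Max (num_ones ` \<L> N))" (is "_ \<Longrightarrow> ?bound")
proof -
  define a where "a = (\<lambda>n. Max (num_ones ` \<L> n))"
  have fin: "finite (\<L> n)" for n
    by (rule finite_subset[OF _ finite_lists_length_eq[of "UNIV :: bool set"]])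
       (use len in auto)
  have sub: "a (m + n) \<le> a m + a n" for m n
  proof -
    have "num_ones W \<le> a m + a n" if W: "W \<in> \<L> (m + n)" for W
    proof -
      have "num_ones W = num_ones (take m W) + num_ones (drop m W)"
        using num_ones_append[of "take m W" "drop m W"] by simp
      also have "\<dots> \<le> a m + a n"
        unfolding a_def using fact[OF W] by (intro add_mono Max_ge) (auto simp: fin)
      finally show ?thesis .
    qed
    hence "Max (num_ones ` \<L> (m + n)) \<le> a m + a n" using ne fin by (subst Max_le_iff) auto
    thus ?thesis by (simp add: a_def)
  qed
  obtain L where L: "(\<lambda>n. real (a n) / real n) \<longlonglongrightarrow> L" "\<And>n. 0 < n \<Longrightarrow> real n * L \<le> real (a n)"
    by (rule fekete[of "\<lambda>n. real (a n)"]) (use sub in \<open>auto simp flip: of_nat_add\<close>)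
  have "lim (\<lambda>n. real (a n) / real n) = L" using L(1) by (rule limI)
  with L show ?conv and "0 < N \<Longrightarrow> ?bound" by (simp_all add: a_def)
qed

section \<open>Invariant measures\<close>

lemma invariant_measureD:
  assumes "\<mu> \<in> invariant_measures Y"
  shows "prob_space \<mu>" "sets \<mu> = sets (restrict_space borel Y)" "space \<mu> = Y"
    "distr \<mu> \<mu> left_shift = \<mu>"
  using assms sets_eq_imp_space_eq[of \<mu> "restrict_space borel Y"]
  by (auto simp: invariant_measures_def space_restrict_space)

lemma open_pattern:
  assumes "finite I"
  shows "open {x::bseq. \<forall>i\<in>I. x i = f i}"
proof -
  have "open (\<Inter>i\<in>I. {x::bseq. x i = f i})"
    by (intro open_INT assms ballI open_coord)
  thus ?thesis by (simp add: Collect_ball_eq)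
qed

lemma pattern_measurable:
  assumes "\<mu> \<in> invariant_measures Y" "finite I"
  shows "{x \<in> Y. \<forall>i\<in>I. x i = f i} \<in> sets \<mu>"
proof -
  have "Y \<inter> {x. \<forall>i\<in>I. x i = f i} \<in> sets (restrict_space borel Y)"
    using open_pattern[OF assms(2)] by (auto simp: sets_restrict_space)
  moreover have "Y \<inter> {x. \<forall>i\<in>I. x i = f i} = {x \<in> Y. \<forall>i\<in>I. x i = f i}" by auto
  ultimately show ?thesis using invariant_measureD(2)[OF assms(1)] by simp
qed

lemma cylinder_measurable:
  assumes "\<mu> \<in> invariant_measures Y"
  shows "cylinder Y W \<in> sets \<mu>"
proof -
  have "cylinder Y W = {x \<in> Y. \<forall>i\<in>int ` {..<length W}. x i = W ! nat i}"
    by (auto simp: cylinder_def)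
  thus ?thesis using pattern_measurable[OF assms, of "int ` {..<length W}" "\<lambda>i. W ! nat i"] by simp
qed

lemma left_shift_measurable:
  assumes "subshift Y" "\<mu> \<in> invariant_measures Y"
  shows "left_shift \<in> measurable \<mu> \<mu>"
proof -
  have "left_shift \<in> measurable (restrict_space borel Y) (restrict_space borel Y)"
    by (rule measurable_restrict_space3[OF measurable_left_shift])
       (use assms in \<open>auto simp: subshift_def\<close>)
  thus ?thesis
    using measurable_cong_sets[OF invariant_measureD(2)[OF assms(2)] invariant_measureD(2)[OF assms(2)]]
    by blast
qed

lemma measure_left_shift_funpow:
  assumes "subshift Y" "\<mu> \<in> invariant_measures Y" "A \<in> sets \<mu>"
  shows "{x \<in> Y. (left_shift ^^ j) x \<in> A} \<in> sets \<mu> \<and>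
         measure \<mu> {x \<in> Y. (left_shift ^^ j) x \<in> A} = measure \<mu> A"
proof (induction j)
  case 0
  have "{x \<in> Y. x \<in> A} = A"
    using sets.sets_into_space[OF assms(3)] invariant_measureD(3)[OF assms(2)] by auto
  thus ?case using assms(3) by simp
next
  case (Suc j)
  note m = left_shift_measurable[OF assms(1,2)]
  let ?B = "{x \<in> Y. (left_shift ^^ j) x \<in> A}"
  have eq: "{x \<in> Y. (left_shift ^^ Suc j) x \<in> A} = left_shift -` ?B \<inter> space \<mu>"
    using subshift_funpow[OF assms(1), of _ 1]
    by (auto simp: invariant_measureD(3)[OF assms(2)] funpow_swap1)
  have "measure \<mu> (left_shift -` ?B \<inter> space \<mu>) = measure (distr \<mu> \<mu> left_shift) ?B"
    using Suc m by (simp add: measure_distr)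
  thus ?case
    unfolding eq using conjunct1[OF Suc] conjunct2[OF Suc] measurable_sets[OF m conjunct1[OF Suc]]
    unfolding invariant_measureD(4)[OF assms(2)] by metis
qed

text \<open>
  By invariance, \<open>n \<mu>[1]\<close> is the integral of the number of ones among the first \<open>n\<close> symbols.
\<close>

lemma measure_one_le_frequency:
  assumes Y: "subshift Y" and \<mu>: "\<mu> \<in> invariant_measures Y"
    and K: "\<And>x. x \<in> Y \<Longrightarrow> real (num_ones (word n x)) \<le> K"
  shows "real n * measure \<mu> (cylinder Y [True]) \<le> K"
proof -
  interpret prob_space \<mu> using invariant_measureD(1)[OF \<mu>] .
  note sp = invariant_measureD(3)[OF \<mu>]
  define E where "E j = {x \<in> Y. (left_shift ^^ j) x \<in> cylinder Y [True]}" for j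
  have E: "E j \<in> sets \<mu>" "measure \<mu> (E j) = measure \<mu> (cylinder Y [True])" for j
    unfolding E_def using measure_left_shift_funpow[OF Y \<mu> cylinder_measurable[OF \<mu>]] by auto
  have int: "integrable \<mu> (indicator (E j) :: _ \<Rightarrow> real)" for j
    using E by (simp add: emeasure_eq_measure)
  have "real n * measure \<mu> (cylinder Y [True]) = (\<Sum>j<n. measure \<mu> (E j))"
    by (simp add: E)
  also have "\<dots> = (\<integral>x. (\<Sum>j<n. indicator (E j) x) \<partial>\<mu>)"
    using E int by (simp add: Bochner_Integration.integral_sum)
  also have "\<dots> \<le> (\<integral>x. K \<partial>\<mu>)"
  proof (rule integral_mono)
    show "integrable \<mu> (\<lambda>x. \<Sum>j<n. indicator (E j) x :: real)"
      by (intro Bochner_Integration.integrable_sum int)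
    fix x assume "x \<in> space \<mu>"
    hence x: "x \<in> Y" by (simp add: sp)
    have "(\<Sum>j<n. indicator (E j) x) = real (num_ones (word n x))"
      unfolding num_ones_word_sum
      by (rule sum.cong) (use x subshift_funpow[OF Y x] in
          \<open>auto simp: E_def cylinder_def left_shift_funpow indicator_def\<close>)
    thus "(\<Sum>j<n. indicator (E j) x) \<le> K" using K[OF x] by simp
  qed simp
  finally show ?thesis by (simp add: prob_space)
qed

lemma language_factorial:
  assumes "subshift X" "W \<in> language (m + n) X"
  shows "take m W \<in> language m X \<and> drop m W \<in> language n X"
  using assms subshift_funpow by (auto simp: language_eq take_word drop_word)

text \<open>
  A cylinder is contained in the cylinder of its initial part and in a preimage, under a power of
  the shift, of the cylinder of its final part.
\<close>

lemma positive_language_factorial: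
  assumes X: "subshift X" and \<nu>: "\<nu> \<in> invariant_measures X"
    and W: "W \<in> language (m + n) X" "0 < measure \<nu> (cylinder X W)"
  shows "0 < measure \<nu> (cylinder X (take m W)) \<and> 0 < measure \<nu> (cylinder X (drop m W))"
proof -
  interpret prob_space \<nu> using invariant_measureD(1)[OF \<nu>] .
  have len: "length W = m + n" using W(1) by (simp add: language_def)
  note meas = cylinder_measurable[OF \<nu>]
  let ?D = "{x \<in> X. (left_shift ^^ m) x \<in> cylinder X (drop m W)}"
  have D: "?D \<in> sets \<nu>" "measure \<nu> ?D = measure \<nu> (cylinder X (drop m W))"
    using measure_left_shift_funpow[OF X \<nu> meas] by auto
  have "cylinder X W \<subseteq> cylinder X (take m W)" using len by (auto simp: cylinder_def)
  hence "measure \<nu> (cylinder X W) \<le> measure \<nu> (cylinder X (take m W))"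
    using meas by (rule finite_measure_mono)
  moreover have "cylinder X W \<subseteq> ?D"
  proof
    fix x assume x: "x \<in> cylinder X W"
    hence "x \<in> X" "word (m + n) x = W" by (auto simp: cylinder_eq len)
    thus "x \<in> ?D"
      using drop_word[of m n x] subshift_funpow[OF X] by (auto simp: cylinder_eq len)
  qed
  hence "measure \<nu> (cylinder X W) \<le> measure \<nu> ?D" using D(1) by (rule finite_measure_mono)
  ultimately show ?thesis using W(2) D(2) by linarith
qed

lemma positive_language_nonempty:
  assumes \<nu>: "\<nu> \<in> invariant_measures X"
  shows "{W \<in> language n X. 0 < measure \<nu> (cylinder X W)} \<noteq> {}"
proof
  interpret prob_space \<nu> using invariant_measureD(1)[OF \<nu>] .
  assume "{W \<in> language n X. 0 < measure \<nu> (cylinder X W)} = {}"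
  hence "\<not> 0 < measure \<nu> (cylinder X W)" if "W \<in> language n X" for W
    using that by blast
  hence zero: "measure \<nu> (cylinder X W) = 0" if "W \<in> language n X" for W
    using that by (simp add: zero_less_measure_iff)
  have "(\<Union>W\<in>language n X. cylinder X W) = X"
    by (auto simp: language_eq cylinder_eq)
  moreover have "measure \<nu> (\<Union>W\<in>language n X. cylinder X W) \<le>
      (\<Sum>W\<in>language n X. measure \<nu> (cylinder X W))"
    by (intro measure_UNION_le) (auto intro: cylinder_measurable[OF \<nu>])
  ultimately have "measure \<nu> X \<le> 0" using zero by simp
  thus False using prob_space invariant_measureD(3)[OF \<nu>] by simp
qed

section \<open>Long words have small measure\<close>

lemma non_atomic_singleton:
  assumes "non_atomic \<nu>" "{x} \<in> sets \<nu>"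
  shows "measure \<nu> {x} = 0"
proof (rule ccontr)
  assume "measure \<nu> {x} \<noteq> 0"
  hence "0 < measure \<nu> {x}" using measure_nonneg[of \<nu> "{x}"] by linarith
  then obtain B where "B \<subseteq> {x}" "0 < measure \<nu> B" "measure \<nu> B < measure \<nu> {x}"
    using assms unfolding non_atomic_def by blast
  thus False by (auto simp: subset_singleton_iff)
qed

text \<open>
  Points are null, and the two-sided cylinders around a point shrink to it, so each point has a
  two-sided cylinder of mass below \<open>\<epsilon>\<close>.  By compactness finitely many of these cover \<open>X\<close>.  Two-sided
  cylinders that meet are nested, so at the largest radius used every cylinder is small; a one-sided
  cylinder of twice that length is a shift of one of them.
\<close>

lemma non_atomic_small_words:
  assumes X: "subshift X" and \<nu>: "\<nu> \<in> invariant_measures X" and na: "non_atomic \<nu>"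
    and \<epsilon>: "0 < \<epsilon>"
  obtains n where "0 < n" "\<And>W. length W = n \<Longrightarrow> measure \<nu> (cylinder X W) < \<epsilon>"
proof -
  interpret prob_space \<nu> using invariant_measureD(1)[OF \<nu>] .
  define C where "C m x = {y. \<forall>i\<in>{- int m..<int m}. y i = x i}" for m and x :: bseq
  have CX: "X \<inter> C m x \<in> sets \<nu>" for m x
    using pattern_measurable[OF \<nu>, of "{- int m..<int m}" x] by (simp add: C_def Int_def)
  have mono: "C m x \<subseteq> C k x" if "k \<le> m" for k m x
    using that by (auto simp: C_def)
  have openC: "open (C m x)" for m x
    unfolding C_def by (rule open_pattern) simp
  have small: "\<exists>m. measure \<nu> (X \<inter> C m x) < \<epsilon>" if x: "x \<in> X" for x
  proof -
    have Int: "(\<Inter>m. X \<inter> C m x) = {x}"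
    proof (intro equalityI subsetI)
      fix y assume y: "y \<in> (\<Inter>m. X \<inter> C m x)"
      have "y i = x i" for i
      proof -
        have "y \<in> C (Suc (nat \<bar>i\<bar>)) x" using y by blast
        moreover have "i \<in> {- int (Suc (nat \<bar>i\<bar>))..<int (Suc (nat \<bar>i\<bar>))}" by auto
        ultimately show ?thesis unfolding C_def by blast
      qed
      thus "y \<in> {x}" by (simp add: fun_eq_iff)
    qed (use x in \<open>auto simp: C_def\<close>)
    have "(\<Inter>m. X \<inter> C m x) \<in> sets \<nu>" by (rule sets.countable_INT) (use CX in auto)
    hence "{x} \<in> sets \<nu>" by (simp only: Int)
    moreover have dec: "decseq (\<lambda>m. X \<inter> C m x)"
      unfolding decseq_def using mono[of _ _ x] by blast
    have "(\<lambda>m. measure \<nu> (X \<inter> C m x)) \<longlonglongrightarrow> measure \<nu> (\<Inter>m. X \<inter> C m x)"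
      by (rule finite_Lim_measure_decseq) (use CX dec in auto)
    ultimately have "(\<lambda>m. measure \<nu> (X \<inter> C m x)) \<longlonglongrightarrow> 0"
      using Int non_atomic_singleton[OF na] by simp
    from order_tendstoD(2)[OF this \<epsilon>] show ?thesis by (auto simp: eventually_sequentially)
  qed
  then obtain m where m: "\<And>x. x \<in> X \<Longrightarrow> measure \<nu> (X \<inter> C (m x) x) < \<epsilon>" by metis
  have "compact X" using X by (simp add: subshift_def closed_imp_compact_bseq)
  moreover have "X \<subseteq> (\<Union>x\<in>X. C (m x) x)" by (auto simp: C_def)
  ultimately obtain F where F: "F \<subseteq> X" "finite F" "X \<subseteq> (\<Union>x\<in>F. C (m x) x)"
    by (metis compactE_image[of X X "\<lambda>x. C (m x) x"] openC)
  define M where "M = Suc (Max (insert 0 (m ` F)))"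
  have Mge: "m x \<le> M" if "x \<in> F" for x
    using that F(2) by (auto simp: M_def intro!: le_SucI Max_ge)
  have "measure \<nu> (cylinder X W) < \<epsilon>" if len: "length W = 2 * M" for W
  proof (cases "cylinder X W = {}")
    case False
    then obtain y where y: "y \<in> X" "\<And>i. i < 2 * M \<Longrightarrow> y (int i) = W ! i"
      by (auto simp: cylinder_def len)
    define x where "x = (left_shift ^^ M) y"
    have x: "x \<in> X" unfolding x_def by (rule subshift_funpow[OF X y(1)])
    have "{z \<in> X. (left_shift ^^ M) z \<in> X \<inter> C M x} = cylinder X W"
    proof -
      have "(\<forall>i\<in>{- int M..<int M}. z (i + int M) = y (i + int M)) \<longleftrightarrow>
          (\<forall>i<2 * M. z (int i) = y (int i))" (is "?l \<longleftrightarrow> ?r") for z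
      proof
        assume l: ?l
        show ?r
        proof (intro allI impI)
          fix i assume "i < 2 * M"
          thus "z (int i) = y (int i)" using l[rule_format, of "int i - int M"] by simp
        qed
      next
        assume r: ?r
        show ?l
        proof
          fix i assume "i \<in> {- int M..<int M}"
          hence "nat (i + int M) < 2 * M" "int (nat (i + int M)) = i + int M" by auto
          thus "z (i + int M) = y (i + int M)" using r by metis
        qed
      qed
      thus ?thesis using y(2) subshift_funpow[OF X, of _ M]
        by (auto simp: C_def cylinder_def len x_def left_shift_funpow)
    qed
    hence eq: "measure \<nu> (cylinder X W) = measure \<nu> (X \<inter> C M x)"
      using measure_left_shift_funpow[OF X \<nu> CX[of M x], of M] by simp
    obtain z where z: "z \<in> F" "x \<in> C (m z) z" using F(3) x by blast
    have "C M x \<subseteq> C (m z) z" using z(2) mono[OF Mge[OF z(1)], of x] by (auto simp: C_def)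
    hence "measure \<nu> (X \<inter> C M x) \<le> measure \<nu> (X \<inter> C (m z) z)"
      by (intro finite_measure_mono CX) auto
    also have "\<dots> < \<epsilon>" using m z(1) F(1) by blast
    finally show ?thesis using eq by simp
  qed (simp add: \<epsilon>)
  thus thesis by (intro that[of "2 * M"]) (auto simp: M_def)
qed

section \<open>The convolution on words with the most ones\<close>

lemma bernoulli_measure_all_ones:
  assumes q: "0 \<le> q" "q \<le> 1" and J: "finite J"
  shows "measure (bernoulli_measure q) {y. \<forall>i\<in>J. y i} = (1 - q) ^ card J"
proof -
  interpret product_prob_space "\<lambda>i::int. measure_pmf (bernoulli_pmf (1 - q))" UNIV
    by unfold_locales
  have *: "{y. \<forall>i\<in>J. y i} =
      prod_emb UNIV (\<lambda>i::int. measure_pmf (bernoulli_pmf (1 - q))) J (\<Pi>\<^sub>E i\<in>J. {True})"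
    by (auto simp: prod_emb_def PiE_iff restrict_def) metis
  have one: "measure (measure_pmf (bernoulli_pmf (1 - q))) {True} = 1 - q"
    using q pmf_bernoulli_True[of "1 - q"] by (simp add: pmf.rep_eq)
  show ?thesis
    unfolding bernoulli_measure_def *
    by (subst measure_PiM_emb) (use J one in auto)
qed

lemma coordinatewise_product_measurable:
  assumes \<nu>: "\<nu> \<in> invariant_measures X"
  shows "(\<lambda>(x, y). (\<lambda>i. x i \<and> y i)) \<in>
    measurable (\<nu> \<Otimes>\<^sub>M bernoulli_measure q) (restrict_space borel (hereditary_closure X))"
proof -
  let ?B = "bernoulli_measure q"
  have bool: "borel_measurable M = measurable M (count_space (UNIV :: bool set))" for M :: "'a measure"
    by (rule measurable_cong_sets) (simp_all add: borel_bool)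
  have coord: "(\<lambda>x::bseq. x i) \<in> borel_measurable borel" for i
    by (intro borel_measurable_continuous_onI continuous_on_product_coordinates)
  have c\<nu>: "(\<lambda>x. x i) \<in> measurable \<nu> (borel :: bool measure)" for i
    using measurable_restrict_space1[OF coord]
      measurable_cong_sets[OF invariant_measureD(2)[OF \<nu>] refl] by blast
  have cB: "(\<lambda>x. x i) \<in> measurable ?B (borel :: bool measure)" for i
    using coord measurable_cong_sets[OF sets_bernoulli_measure refl] by blast
  have "(\<lambda>z. \<lambda>i. fst z i \<and> snd z i) \<in> borel_measurable (\<nu> \<Otimes>\<^sub>M ?B)"
  proof (rule measurable_coordinatewise_then_product)
    fix i
    have "(\<lambda>z. fst z i) \<in> borel_measurable (\<nu> \<Otimes>\<^sub>M ?B)"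
      by (rule measurable_compose[OF measurable_fst c\<nu>])
    moreover have "(\<lambda>z. snd z i) \<in> borel_measurable (\<nu> \<Otimes>\<^sub>M ?B)"
      by (rule measurable_compose[OF measurable_snd cB])
    ultimately show "(\<lambda>z. fst z i \<and> snd z i) \<in> borel_measurable (\<nu> \<Otimes>\<^sub>M ?B)"
      unfolding bool by (rule pred_intros_logic)
  qed
  hence "(\<lambda>(x, y). (\<lambda>i. x i \<and> y i)) \<in> borel_measurable (\<nu> \<Otimes>\<^sub>M ?B)"
    by (simp add: case_prod_beta)
  thus ?thesis
    by (rule measurable_restrict_space2[rotated])
       (auto simp: hereditary_closure_def space_pair_measure invariant_measureD(3)[OF \<nu>])
qed

text \<open>
  The preimage of the cylinder of \<open>W\<close> under the coordinatewise product lies between two rectangles.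
  Both have as second side the sequences equal to 1 wherever \<open>W\<close> is.  The first sides are the cylinder of
  \<open>W\<close> and the set \<open>A\<close> of points whose initial word dominates \<open>W\<close>; by maximality of \<open>W\<close> these
  have the same mass.
\<close>

lemma mult_conv_maximal_word:
  assumes \<nu>: "\<nu> \<in> invariant_measures X" and q: "0 \<le> q" "q \<le> 1"
    and max: "\<And>V. V \<in> language (length W) X \<Longrightarrow> 0 < measure \<nu> (cylinder X V) \<Longrightarrow>
      num_ones V \<le> num_ones W"
  shows "measure (mult_conv X \<nu> (bernoulli_measure q)) (cylinder (hereditary_closure X) W) =
    measure \<nu> (cylinder X W) * (1 - q) ^ num_ones W"
proof -
  let ?B = "bernoulli_measure q" and ?H = "hereditary_closure X"
  let ?Q = "\<lambda>(x::bseq, y::bseq). (\<lambda>i. x i \<and> y i)"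
  let ?n = "length W"
  interpret B: prob_space ?B by (rule prob_space_bernoulli_measure)
  interpret N: prob_space \<nu> using invariant_measureD(1)[OF \<nu>] .
  interpret P: pair_prob_space \<nu> ?B ..
  note sp = invariant_measureD(3)[OF \<nu>] and meas = cylinder_measurable[OF \<nu>]
  have spB: "space ?B = UNIV" using sets_eq_imp_space_eq[OF sets_bernoulli_measure] by simp
  define J where "J = int ` {i. i < ?n \<and> W ! i}"
  define O1 where "O1 = {y::bseq. \<forall>i\<in>J. y i}"
  define A where "A = {x \<in> X. \<forall>i\<in>J. x i}"
  define E where "E = ?Q -` cylinder ?H W \<inter> space (\<nu> \<Otimes>\<^sub>M ?B)"
  have J: "finite J" "card J = num_ones W"
    by (auto simp: J_def num_ones_def card_image)
  have A: "A \<in> sets \<nu>"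
    using pattern_measurable[OF \<nu> J(1), of "\<lambda>_. True"] by (simp add: A_def)
  have O1: "O1 \<in> sets ?B"
    using open_pattern[OF J(1), of "\<lambda>_. True"] by (simp add: sets_bernoulli_measure O1_def)
  have pO1: "measure ?B O1 = (1 - q) ^ num_ones W"
    unfolding O1_def by (subst bernoulli_measure_all_ones[OF q J(1)]) (simp add: J(2))
  have cyl_H: "cylinder ?H W \<in> sets (restrict_space borel ?H)"
  proof -
    have "cylinder ?H W = ?H \<inter> {x. \<forall>i\<in>int ` {..<?n}. x i = W ! nat i}"
      by (auto simp: cylinder_def)
    moreover have "open {x::bseq. \<forall>i\<in>int ` {..<?n}. x i = W ! nat i}"
      by (rule open_pattern) simp
    ultimately show ?thesis by (auto simp: sets_restrict_space)
  qed
  note Q = coordinatewise_product_measurable[OF \<nu>, of q]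
  have E: "E \<in> sets (\<nu> \<Otimes>\<^sub>M ?B)" unfolding E_def by (rule measurable_sets[OF Q cyl_H])
  have cylA: "cylinder X W \<subseteq> A" by (auto simp: cylinder_def A_def J_def)
  \<comment> \<open>Any other word that dominates \<open>W\<close> has more ones than \<open>W\<close>, so it is null.\<close>
  have \<nu>A: "measure \<nu> A = measure \<nu> (cylinder X W)"
  proof (rule antisym)
    let ?V = "{V \<in> language ?n X. V \<noteq> W \<and> (\<forall>i<?n. W ! i \<longrightarrow> V ! i)}"
    have fin: "finite ?V" by (rule finite_subset[OF _ finite_language[of ?n X]]) auto
    have zero: "measure \<nu> (cylinder X V) = 0" if V: "V \<in> ?V" for V
    proof (rule ccontr)
      assume "measure \<nu> (cylinder X V) \<noteq> 0"
      hence "0 < measure \<nu> (cylinder X V)" by (simp add: zero_less_measure_iff)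
      hence le: "num_ones V \<le> num_ones W" using max V by blast
      have len: "length V = ?n" using V by (auto simp: language_def)
      obtain i where i: "i < ?n" "V ! i \<noteq> W ! i" using V len by (auto simp: list_eq_iff_nth_eq)
      have "{i. i < ?n \<and> W ! i} \<subset> {i. i < ?n \<and> V ! i}" using V i by blast
      hence "num_ones W < num_ones V"
        unfolding num_ones_def len by (intro psubset_card_mono) auto
      thus False using le by simp
    qed
    have "A \<subseteq> cylinder X W \<union> (\<Union>V\<in>?V. cylinder X V)"
    proof
      fix x assume x: "x \<in> A"
      have "word ?n x = W \<or> word ?n x \<in> ?V"
        using x by (auto simp: A_def J_def language_eq word_def)
      thus "x \<in> cylinder X W \<union> (\<Union>V\<in>?V. cylinder X V)"
        using x by (auto simp: cylinder_eq A_def)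
    qed
    hence "measure \<nu> A \<le> measure \<nu> (cylinder X W \<union> (\<Union>V\<in>?V. cylinder X V))"
      by (rule N.finite_measure_mono) (use meas fin in auto)
    also have "\<dots> \<le> measure \<nu> (cylinder X W) + measure \<nu> (\<Union>V\<in>?V. cylinder X V)"
      by (rule measure_Un_le) (use meas fin in auto)
    also have "measure \<nu> (\<Union>V\<in>?V. cylinder X V) \<le> (\<Sum>V\<in>?V. measure \<nu> (cylinder X V))"
      by (rule measure_UNION_le) (use meas fin in auto)
    also have "\<dots> = 0" using zero by (intro sum.neutral) blast
    finally show "measure \<nu> A \<le> measure \<nu> (cylinder X W)" by simp
  qed (rule N.finite_measure_mono[OF cylA A])
  have prod: "measure (\<nu> \<Otimes>\<^sub>M ?B) (S \<times> O1) = measure \<nu> S * (1 - q) ^ num_ones W"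
    if "S \<in> sets \<nu>" for S
    using that O1 unfolding pO1[symmetric]
    by (simp add: measure_def B.emeasure_pair_measure_Times enn2real_mult)
  have "cylinder X W \<times> O1 \<subseteq> E"
    by (auto simp: E_def cylinder_def hereditary_closure_def space_pair_measure sp spB O1_def J_def)
  hence lower: "measure (\<nu> \<Otimes>\<^sub>M ?B) (cylinder X W \<times> O1) \<le> measure (\<nu> \<Otimes>\<^sub>M ?B) E"
    using E by (rule P.finite_measure_mono)
  have "E \<subseteq> A \<times> O1"
    by (auto simp: E_def cylinder_def space_pair_measure sp A_def O1_def J_def)
  hence upper: "measure (\<nu> \<Otimes>\<^sub>M ?B) E \<le> measure (\<nu> \<Otimes>\<^sub>M ?B) (A \<times> O1)"
    by (rule P.finite_measure_mono) (use A O1 in auto)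
  have "measure (mult_conv X \<nu> ?B) (cylinder ?H W) = measure (\<nu> \<Otimes>\<^sub>M ?B) E"
    unfolding mult_conv_def E_def by (rule measure_distr[OF Q cyl_H])
  also have "\<dots> = measure \<nu> (cylinder X W) * (1 - q) ^ num_ones W"
    using lower upper prod[OF A] prod[OF meas] \<nu>A by simp
  finally show ?thesis .
qed

section \<open>Bounds for a continuous potential\<close>

lemma bounded_continuous_image:
  fixes \<phi> :: "bseq \<Rightarrow> real"
  assumes "closed Y" "continuous_on Y \<phi>"
  shows "bounded (\<phi> ` Y)"
  using compact_continuous_image[OF assms(2) closed_imp_compact_bseq[OF assms(1)]]
  by (rule compact_imp_bounded)

lemma birkhoff_sum_ge:
  assumes Y: "subshift Y" and \<phi>: "continuous_on Y \<phi>" and x: "x \<in> Y"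
  shows "real (num_ones (word n x)) * (INF z\<in>cylinder Y [True]. \<phi> z) +
    (real n - real (num_ones (word n x))) * (INF z\<in>cylinder Y [False]. \<phi> z) \<le> birkhoff_sum \<phi> n x"
    (is "?k * ?i1 + _ * ?i0 \<le> _")
proof -
  have bnd: "bounded (\<phi> ` Y)"
    using Y \<phi> by (simp add: subshift_def bounded_continuous_image)
  have bdd: "bdd_below (\<phi> ` cylinder Y W)" for W
    by (rule bdd_below_mono[OF bounded_imp_bdd_below[OF bnd]]) (auto simp: cylinder_def)
  have "?k * ?i1 + (real n - ?k) * ?i0 = (\<Sum>i<n. if x (int i) then ?i1 else ?i0)"
  proof -
    have "(\<Sum>i<n. if x (int i) then ?i1 else ?i0) =
        (\<Sum>i<n. (if x (int i) then 1 else 0) * (?i1 - ?i0) + ?i0)"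
      by (intro sum.cong) auto
    also have "\<dots> = ?k * (?i1 - ?i0) + real n * ?i0"
      by (simp add: sum.distrib num_ones_word_sum sum_distrib_right)
    finally show ?thesis by (simp add: algebra_simps)
  qed
  also have "\<dots> \<le> birkhoff_sum \<phi> n x"
    unfolding birkhoff_sum_def
  proof (rule sum_mono)
    fix i
    let ?y = "(left_shift ^^ i) x"
    have "?y \<in> cylinder Y [x (int i)]"
      using subshift_funpow[OF Y x] by (auto simp: cylinder_def left_shift_funpow)
    hence "(INF z\<in>cylinder Y [x (int i)]. \<phi> z) \<le> \<phi> ?y" by (rule cINF_lower[OF bdd])
    thus "(if x (int i) then ?i1 else ?i0) \<le> \<phi> ?y" by (cases "x (int i)") auto
  qed
  finally show ?thesis .
qed

lemma integral_le_by_symbols: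
  assumes Y: "closed Y" and \<phi>: "continuous_on Y \<phi>" and \<mu>: "\<mu> \<in> invariant_measures Y"
  shows "(\<integral>x. \<phi> x \<partial>\<mu>) \<le>
    measure \<mu> (cylinder Y [True]) * (SUP z\<in>cylinder Y [True]. \<phi> z) +
    (1 - measure \<mu> (cylinder Y [True])) * (SUP z\<in>cylinder Y [False]. \<phi> z)"
    (is "_ \<le> ?m * ?s1 + _ * ?s0")
proof -
  interpret prob_space \<mu> using invariant_measureD(1)[OF \<mu>] .
  note sp = invariant_measureD(3)[OF \<mu>]
  let ?I = "indicator (cylinder Y [True]) :: bseq \<Rightarrow> real"
  have bnd: "bounded (\<phi> ` Y)" by (rule bounded_continuous_image[OF Y \<phi>])
  have bdd: "bdd_above (\<phi> ` cylinder Y W)" for W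
    by (rule bdd_above_mono[OF bounded_imp_bdd_above[OF bnd]]) (auto simp: cylinder_def)
  have "\<phi> \<in> borel_measurable (restrict_space borel Y)"
    by (rule borel_measurable_continuous_on_restrict[OF \<phi>])
  hence meas: "\<phi> \<in> borel_measurable \<mu>"
    using measurable_cong_sets[OF invariant_measureD(2)[OF \<mu>] refl] by blast
  obtain b where "\<And>x. x \<in> Y \<Longrightarrow> norm (\<phi> x) \<le> b" using bnd by (auto simp: bounded_iff)
  hence int\<phi>: "integrable \<mu> \<phi>" by (intro integrable_const_bound[of _ b] meas AE_I2) (auto simp: sp)
  have intI: "integrable \<mu> ?I" using cylinder_measurable[OF \<mu>] by (simp add: emeasure_eq_measure)
  have "(\<integral>x. \<phi> x \<partial>\<mu>) \<le> (\<integral>x. ?I x * (?s1 - ?s0) + ?s0 \<partial>\<mu>)"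
  proof (rule integral_mono[OF int\<phi>])
    show "integrable \<mu> (\<lambda>x. ?I x * (?s1 - ?s0) + ?s0)" using intI by simp
    fix x assume "x \<in> space \<mu>"
    hence "x \<in> cylinder Y [x 0]" by (simp add: sp cylinder_def)
    hence "\<phi> x \<le> (SUP z\<in>cylinder Y [x 0]. \<phi> z)" by (rule cSUP_upper[OF _ bdd])
    moreover have "?I x = (if x 0 then 1 else 0)"
      using \<open>x \<in> space \<mu>\<close> by (auto simp: sp cylinder_def indicator_def)
    ultimately show "\<phi> x \<le> ?I x * (?s1 - ?s0) + ?s0" by (cases "x 0") auto
  qed
  also have "\<dots> = ?m * (?s1 - ?s0) + ?s0"
    using intI cylinder_measurable[OF \<mu>] by (simp add: prob_space)
  finally show ?thesis by (simp add: algebra_simps)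
qed

text \<open>
  The point mass at a fixed point is ergodic.  A supremum over the ergodic measures can be bounded only when
  there are some; in a hereditary closure, the zero sequence is such a fixed point.
\<close>

lemma ergodic_measures_nonempty:
  assumes Y: "subshift Y" and x: "x \<in> Y" "left_shift x = x"
  shows "ergodic_measures Y \<noteq> {}"
proof -
  let ?R = "restrict_space borel Y"
  let ?\<delta> = "return ?R x"
  have sp: "x \<in> space ?R" using x by (simp add: space_restrict_space)
  have "left_shift \<in> measurable ?R ?R"
    by (rule measurable_restrict_space3[OF measurable_left_shift])
       (use Y in \<open>auto simp: subshift_def\<close>)
  hence "distr ?\<delta> ?R left_shift = ?\<delta>" using distr_return[OF _ sp] x(2) by metis
  moreover have "distr ?\<delta> ?\<delta> left_shift = distr ?\<delta> ?R left_shift"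
    by (rule distr_cong) auto
  ultimately have "?\<delta> \<in> invariant_measures Y"
    using prob_space_return[OF sp] by (simp add: invariant_measures_def)
  moreover have "measure ?\<delta> A = 0 \<or> measure ?\<delta> A = 1" if "A \<in> sets ?R" for A
    using that by (simp add: measure_return indicator_def)
  ultimately have "?\<delta> \<in> ergodic_measures Y" by (simp add: ergodic_measures_def)
  thus ?thesis by blast
qed

section \<open>Failure of the Gibbs property\<close>

theorem theorem1p1:
  fixes X Xt :: "bseq set" and \<nu> \<kappa> :: "bseq measure" and q Pt :: real and \<phi> :: "bseq \<Rightarrow> real"
  assumes X: "subshift X"
    and Xt: "Xt = hereditary_closure X"
    and \<nu>: "\<nu> \<in> ergodic_measures X"
    and \<nu>_non_atomic: "non_atomic \<nu>"
    and \<nu>_density: "dens_max_measure X \<nu> = dens_max X"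
    and q: "0 < q" "q < 1"
    and \<kappa>: "\<kappa> = mult_conv X \<nu> (bernoulli_measure q)"
    and \<phi>: "continuous_on Xt \<phi>"
    and \<phi>_density: "fdens_max_measure Xt \<phi> \<kappa> = fdens_max Xt \<phi>"
    and Pt: "Pt = pressure Xt \<phi>"
    and pressure_le:
      "Pt \<le> (Var \<phi> (cylinder Xt [False]) - log 2 (1 - q) - Var \<phi> (cylinder Xt [True])) * dens_sup X
             + fdens_sup Xt \<phi> - Var \<phi> (cylinder Xt [False])"
    and sup_le: "(SUP x\<in>cylinder Xt [True]. \<phi> x) \<ge> (SUP x\<in>cylinder Xt [False]. \<phi> x)"
    and Var_le: "Var \<phi> (cylinder Xt [True]) \<le> Var \<phi> (cylinder Xt [False]) - log 2 (1 - q)"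
  shows "\<not> gibbs_measure Xt \<phi> \<kappa>"
proof
  assume "gibbs_measure Xt \<phi> \<kappa>"
  then obtain c where c: "0 < c" and gibbs: "\<And>n C x. C \<in> language n Xt \<Longrightarrow>
      0 < measure \<kappa> (cylinder Xt C) \<Longrightarrow> x \<in> cylinder Xt C \<Longrightarrow>
      1 / c \<le> measure \<kappa> (cylinder Xt C) / 2 powr (birkhoff_sum \<phi> n x - real n * Pt)"
    unfolding gibbs_measure_def Pt by blast
  have \<nu>_inv: "\<nu> \<in> invariant_measures X" using \<nu> by (simp add: ergodic_measures_def)
  interpret prob_space \<nu> using invariant_measureD(1)[OF \<nu>_inv] .
  have Y: "subshift Xt" unfolding Xt by (rule subshift_hereditary_closure[OF X])
  have sub: "X \<subseteq> Xt" by (auto simp: Xt hereditary_closure_def)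
  have "X \<noteq> {}" using not_empty invariant_measureD(3)[OF \<nu>_inv] by simp

  define a where "a n = Max (num_ones ` language n X)" for n
  define k where "k n = Max (num_ones ` {W \<in> language n X. 0 < measure \<nu> (cylinder X W)})" for n
  have lim_a: "(\<lambda>n. real (a n) / real n) \<longlonglongrightarrow> dens_max X"
    unfolding dens_max_def a_def
  proof (rule factorial_language_density(1))
    show "language n X \<noteq> {}" for n using \<open>X \<noteq> {}\<close> by (simp add: language_eq)
    show "length W = n" if "W \<in> language n X" for n W using that by (simp add: language_def)
  qed (rule language_factorial[OF X])
  have k_ge: "real n * dens_max X \<le> real (k n)" if "0 < n" for n
    unfolding \<nu>_density[symmetric] dens_max_measure_def k_def
  proof (rule factorial_language_density(2)[OF _ _ _ that])
    let ?L = "\<lambda>n. {W \<in> language n X. 0 < measure \<nu> (cylinder X W)}"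
    show "?L n \<noteq> {}" for n by (rule positive_language_nonempty[OF \<nu>_inv])
    show "length W = n" if "W \<in> ?L n" for n W using that by (simp add: language_def)
    show "take m W \<in> ?L m \<and> drop m W \<in> ?L n" if "W \<in> ?L (m + n)" for m n W
      using that language_factorial[OF X] positive_language_factorial[OF X \<nu>_inv] by blast
  qed

  have freq: "real (num_ones (word n y)) \<le> real (a n)" if "y \<in> Xt" for n y
  proof -
    obtain x where x: "x \<in> X" "\<And>i. y i \<le> x i" using \<open>y \<in> Xt\<close> by (auto simp: Xt hereditary_closure_def)
    have "num_ones (word n y) \<le> num_ones (word n x)"
      unfolding num_ones_word using x(2) by (intro card_mono) auto
    also have "\<dots> \<le> a n" unfolding a_def
      using x(1) by (intro Max_ge finite_imageI finite_language) (simp add: language_eq)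
    finally show ?thesis by simp
  qed
  have one_le: "measure \<mu> (cylinder Z [True]) \<le> dens_max X"
    if "subshift Z" "Z \<subseteq> Xt" "\<mu> \<in> invariant_measures Z" for Z \<mu>
  proof (rule tendsto_lowerbound[OF lim_a _ sequentially_bot])
    have "measure \<mu> (cylinder Z [True]) \<le> real (a n) / real n" if "0 < n" for n
      using measure_one_le_frequency[OF \<open>subshift Z\<close> \<open>\<mu> \<in> _\<close>, of n "real (a n)"] freq \<open>Z \<subseteq> Xt\<close> that
      by (auto simp: field_simps)
    thus "\<forall>\<^sub>F n in sequentially. measure \<mu> (cylinder Z [True]) \<le> real (a n) / real n"
      by (auto intro: eventually_mono[OF eventually_gt_at_top[of 0]])
  qed
  have d_le: "dens_sup X \<le> dens_max X"
    unfolding dens_sup_def by (rule cSUP_least) (use \<nu>_inv one_le[OF X sub] in auto)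
  let ?s1 = "SUP x\<in>cylinder Xt [True]. \<phi> x" and ?s0 = "SUP x\<in>cylinder Xt [False]. \<phi> x"
  let ?v1 = "Var \<phi> (cylinder Xt [True])" and ?v0 = "Var \<phi> (cylinder Xt [False])"
  let ?l = "log 2 (1 - q)"
  have d\<phi>_le: "fdens_sup Xt \<phi> \<le> ?s0 + dens_max X * (?s1 - ?s0)"
    unfolding fdens_sup_def
  proof (rule cSUP_least)
    have "(\<lambda>_. False) \<in> Xt" using \<open>X \<noteq> {}\<close> by (auto simp: Xt hereditary_closure_def)
    thus "ergodic_measures Xt \<noteq> {}"
      by (rule ergodic_measures_nonempty[OF Y]) (simp add: left_shift_def)
    fix \<mu> assume "\<mu> \<in> ergodic_measures Xt"
    hence \<mu>: "\<mu> \<in> invariant_measures Xt" by (simp add: ergodic_measures_def)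
    have "closed Xt" using Y by (simp add: subshift_def)
    hence "(\<integral>x. \<phi> x \<partial>\<mu>) \<le> ?s0 + measure \<mu> (cylinder Xt [True]) * (?s1 - ?s0)"
      using integral_le_by_symbols[OF _ \<phi> \<mu>] by (simp add: algebra_simps)
    also have "\<dots> \<le> ?s0 + dens_max X * (?s1 - ?s0)"
      using one_le[OF Y order.refl \<mu>] sup_le by (intro add_left_mono mult_right_mono) auto
    finally show "(\<integral>x. \<phi> x \<partial>\<mu>) \<le> ?s0 + dens_max X * (?s1 - ?s0)" .
  qed

  \<comment> \<open>A length at which every word has \<open>\<nu>\<close>-mass below the bound that the Gibbs property would force.\<close>
  obtain n where n: "0 < n" "\<And>W. length W = n \<Longrightarrow> measure \<nu> (cylinder X W) < 1 / c"
    using non_atomic_small_words[OF X \<nu>_inv \<nu>_non_atomic, of "1 / c"] c by auto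
  have "k n \<in> num_ones ` {W \<in> language n X. 0 < measure \<nu> (cylinder X W)}"
    unfolding k_def using positive_language_nonempty[OF \<nu>_inv] by (intro Max_in) auto
  then obtain W where W: "W \<in> language n X" "0 < measure \<nu> (cylinder X W)" "num_ones W = k n" by auto
  have len: "length W = n" using W(1) by (simp add: language_def)
  have "measure \<kappa> (cylinder Xt W) = measure \<nu> (cylinder X W) * (1 - q) ^ num_ones W"
    unfolding \<kappa> Xt
  proof (rule mult_conv_maximal_word[OF \<nu>_inv])
    fix V assume "V \<in> language (length W) X" "0 < measure \<nu> (cylinder X V)"
    thus "num_ones V \<le> num_ones W" unfolding W(3) k_def len by (intro Max_ge) auto
  qed (use q in auto)
  also have "(1 - q) ^ num_ones W = 2 powr (real (k n) * ?l)"
    using q by (simp add: W(3) powr_powr[symmetric] mult.commute[of "real (k n)"] powr_realpow)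
  finally have \<kappa>W: "measure \<kappa> (cylinder Xt W) = measure \<nu> (cylinder X W) * 2 powr (real (k n) * ?l)" .
  obtain x where x: "x \<in> X" "word n x = W" using W(1) by (auto simp: language_eq)
  have xt: "x \<in> Xt" using x(1) sub by blast
  \<comment> \<open>Passing from \<open>n D\<close> to \<open>k n\<close> needs a nonnegative coefficient; this is what the assumptions on the
    suprema and on the variations provide.\<close>
  have exponent: "0 \<le> birkhoff_sum \<phi> n x - real n * Pt - real (k n) * ?l"
  proof -
    let ?D = "dens_max X" and ?k = "real (k n)" and ?n = "real n"
    have "Pt \<le> (?v0 - ?l - ?v1) * ?D + (?s0 + ?D * (?s1 - ?s0)) - ?v0"
      using pressure_le d\<phi>_le mult_left_mono[OF d_le, of "?v0 - ?l - ?v1"] Var_le by simp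
    also have "\<dots> = ?D * (?v0 - ?l - ?v1 + (?s1 - ?s0)) + ?s0 - ?v0"
      by (simp add: algebra_simps)
    finally have "?n * Pt \<le> ?n * (?D * (?v0 - ?l - ?v1 + (?s1 - ?s0)) + ?s0 - ?v0)"
      by (rule mult_left_mono) simp
    also have "\<dots> = (?n * ?D) * (?v0 - ?l - ?v1 + (?s1 - ?s0)) + ?n * (?s0 - ?v0)"
      by (simp add: algebra_simps)
    also have "\<dots> \<le> ?k * (?v0 - ?l - ?v1 + (?s1 - ?s0)) + ?n * (?s0 - ?v0)"
      using k_ge[OF n(1)] Var_le sup_le by (intro add_right_mono mult_right_mono) auto
    also have "\<dots> = ?k * (?s1 - ?v1) + (?n - ?k) * (?s0 - ?v0) - ?k * ?l"
      by (simp add: algebra_simps)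
    also have "?k * (?s1 - ?v1) + (?n - ?k) * (?s0 - ?v0) \<le> birkhoff_sum \<phi> n x"
      using birkhoff_sum_ge[OF Y \<phi> xt, of n] by (simp add: Var_def x(2) W(3))
    finally show ?thesis by simp
  qed
  have "1 / c \<le> measure \<kappa> (cylinder Xt W) / 2 powr (birkhoff_sum \<phi> n x - real n * Pt)"
  proof (rule gibbs)
    show "W \<in> language n Xt" using W(1) sub by (auto simp: language_eq)
    show "0 < measure \<kappa> (cylinder Xt W)" using W(2) by (simp add: \<kappa>W)
    show "x \<in> cylinder Xt W" using xt x(2) by (simp add: cylinder_eq len)
  qed
  also have "\<dots> = measure \<nu> (cylinder X W) *
      2 powr (- (birkhoff_sum \<phi> n x - real n * Pt - real (k n) * ?l))"
    by (simp add: \<kappa>W powr_diff powr_minus field_simps powr_add)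
  also have "\<dots> \<le> measure \<nu> (cylinder X W) * 2 powr 0"
    using exponent by (intro mult_left_mono powr_mono) auto
  finally have "1 / c \<le> measure \<nu> (cylinder X W)" by simp
  with n(2)[OF len] show False by simp
qed

end
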